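(* Let $a(x)$ be a formal power series over $\mathbb{C}$ with $a_0=1$, and for $n\ge0$ let $$h_n(t)=(1-t)^{2n+1}\sum_{m\ge0}\frac{(n+m)!}{m!}[x^n]\big(a^{m+1}(x)\big)t^m$$ be the $n$-th numerator polynomial of the exponential Riordan matrix $(a(x),xa(x))_E$. Then the numerator polynomials are all symmetric, i.e. $h_n(t)=t^nh_n(1/t)$ for every $n\ge0$, if and only if $a(x)=\frac{1}{1-\varphi x}$ for some $\varphi\in\mathbb{C}$ (i.e. the matrix is $|e^x|^{-1}P^{\varphi}|e^x|$).
   Context: The exponential Riordan matrix $(f(x),g(x))_E$ has $(i,j)$ entry $\frac{i!}{j!}[x^i]f(x)g^j(x)$; its $n$-th numerator polynomial is the polynomial $h_n$ such that the $n$-th descending diagonal (entries at $(n+m,m)$) has generating function $h_n(t)/(1-t)^{2n+1}$; $h_n$ has degree at most $n$. $P^{\varphi}=\big(\frac{1}{1-\varphi x},\frac{x}{1-\varphi x}\big)$ is the power of the Pascal matrix, and $|e^x|^{-1}P^{\varphi}|e^x|=\big(\frac{1}{1-\varphi x},\frac{x}{1-\varphi x}\big)_E$. The "exponential Bell subgroup" consists of the matrices $(a(x),xa(x))_E$. *)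

theory Defs
  imports Complex_Main "HOL-Computational_Algebra.Polynomial_FPS"
begin

text \<open>Infinite matrices are functions of a row and a column index, both starting at 0.\<close>

type_synonym cmatrix = "nat \<Rightarrow> nat \<Rightarrow> complex"

definition riordan :: "complex fps \<Rightarrow> complex fps \<Rightarrow> cmatrix" where
  "riordan f g i j = fps_nth (f * g ^ j) i"

definition exp_riordan :: "complex fps \<Rightarrow> complex fps \<Rightarrow> cmatrix" where
  "exp_riordan f g i j = fact i / fact j * fps_nth (f * g ^ j) i"

text \<open>The polynomial \<open>h\<^sub>n\<close> such that the \<open>n\<close>-th descending diagonal of the matrix, with entries
  at \<open>(n + m, m)\<close>, has generating function \<open>h\<^sub>n(t) / (1 - t)\<^sup>2\<^sup>n\<^sup>+\<^sup>1\<close>. Such a polynomial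
  is unique if it exists; existence for the matrices \<open>(a(x), x a(x))\<^sub>E\<close> is shown below.\<close>

definition numerator_poly :: "cmatrix \<Rightarrow> nat \<Rightarrow> complex poly" where
  "numerator_poly A n =
     (THE p. Abs_fps (\<lambda>m. A (n + m) m) = fps_of_poly p / (1 - fps_X) ^ (2 * n + 1))"

definition pascal_power :: "complex \<Rightarrow> cmatrix" where
  "pascal_power \<phi> = riordan (1 / (1 - fps_const \<phi> * fps_X)) (fps_X / (1 - fps_const \<phi> * fps_X))"

text \<open>The diagonal matrix \<open>|b(x)|\<close> has the coefficients of \<open>b(x)\<close> on its diagonal. The matrix
  product sums over all \<open>k \<le> i\<close>, which is the full product when the left factor is lower
  triangular.\<close>

definition diag_matrix :: "complex fps \<Rightarrow> cmatrix" where
  "diag_matrix b i j = (if i = j then fps_nth b i else 0)"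

definition diag_matrix_inv :: "complex fps \<Rightarrow> cmatrix" where
  "diag_matrix_inv b i j = (if i = j then inverse (fps_nth b i) else 0)"

definition lower_mult :: "cmatrix \<Rightarrow> cmatrix \<Rightarrow> cmatrix" where
  "lower_mult A B i j = (\<Sum>k\<le>i. A i k * B k j)"

lemma conj_diag_matrix:
  assumes "\<And>i j. i < j \<Longrightarrow> A i j = 0"
  shows "lower_mult (lower_mult (diag_matrix_inv b) A) (diag_matrix b) i j =
         inverse (fps_nth b i) * A i j * fps_nth b j"
proof -
  have 1: "lower_mult (diag_matrix_inv b) A i k = inverse (fps_nth b i) * A i k" for k
    by (simp add: lower_mult_def diag_matrix_inv_def if_distrib[of "\<lambda>c. c * _"] cong: if_cong)
  have "lower_mult (lower_mult (diag_matrix_inv b) A) (diag_matrix b) i j =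
     (\<Sum>k\<le>i. if k = j then inverse (fps_nth b i) * A i j * fps_nth b j else 0)"
    unfolding lower_mult_def[of "lower_mult _ _"] 1 by (intro sum.cong) (auto simp: diag_matrix_def)
  then show ?thesis
    using assms[of i j] by auto
qed

lemma riordan_lower:
  assumes "fps_nth g 0 = 0" "i < j"
  shows "riordan f g i j = 0"
proof -
  have "fps_nth (g ^ j) k = 0" if "k < j" for k
    using startsby_zero_power_prefix[OF assms(1)] that by blast
  then show ?thesis
    using assms(2) by (auto simp: riordan_def fps_mult_nth intro!: sum.neutral)
qed

lemma conj_pascal_power:
  "lower_mult (lower_mult (diag_matrix_inv (fps_exp 1)) (pascal_power \<phi>)) (diag_matrix (fps_exp 1)) =
   exp_riordan (1 / (1 - fps_const \<phi> * fps_X)) (fps_X / (1 - fps_const \<phi> * fps_X))"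
proof (intro ext)
  fix i j
  let ?g = "fps_X / (1 - fps_const \<phi> * fps_X)"
  have "fps_nth ?g 0 = 0"
    by (simp add: fps_divide_unit)
  then have "\<And>i j. i < j \<Longrightarrow> pascal_power \<phi> i j = 0"
    by (simp add: pascal_power_def riordan_lower)
  then show "lower_mult (lower_mult (diag_matrix_inv (fps_exp 1)) (pascal_power \<phi>))
       (diag_matrix (fps_exp 1)) i j = exp_riordan (1 / (1 - fps_const \<phi> * fps_X)) ?g i j"
    by (simp add: conj_diag_matrix pascal_power_def riordan_def exp_riordan_def divide_simps)
qed

lemma exp_riordan_bell_diag:
  "exp_riordan a (fps_X * a) (n + m) m = fact (n + m) / fact m * fps_nth (a ^ (m + 1)) n"
proof -
  have "a * (fps_X * a) ^ m = fps_X ^ m * a ^ (m + 1)"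
    by (simp add: power_mult_distrib mult_ac)
  then show ?thesis
    by (simp only: exp_riordan_def) (simp add: fps_X_power_mult_nth)
qed

lemma binomial_gf:
  "Abs_fps (\<lambda>m. of_nat ((m + n) choose (n + k)) :: complex) * (1 - fps_X) ^ (n + k + 1) = fps_X ^ k"
proof -
  have i: "inverse ((1 - fps_X) ^ (n + k + 1) :: complex fps) =
       Abs_fps (\<lambda>m. of_nat ((n + k + m) choose m))"
    using one_minus_const_fps_X_neg_power'[of "n + k + 1" "1::complex"] by (simp del: power_Suc)
  have "Abs_fps (\<lambda>m. of_nat ((m + n) choose (n + k)) :: complex) =
        fps_X ^ k * inverse ((1 - fps_X) ^ (n + k + 1))"
    unfolding i
  proof (rule fps_ext)
    fix m
    show "fps_nth (Abs_fps (\<lambda>m. of_nat ((m + n) choose (n + k)) :: complex)) m =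
          fps_nth (fps_X ^ k * Abs_fps (\<lambda>m. of_nat ((n + k + m) choose m))) m"
    proof (cases "k \<le> m")
      case True
      then have "(m + n) choose (n + k) = (m + n) choose (m - k)"
        using binomial_symmetric[of "n + k" "m + n"] by simp
      then show ?thesis
        using True by (simp add: fps_X_power_mult_nth add_ac)
    qed (simp add: fps_X_power_mult_nth)
  qed
  moreover have "inverse ((1 - fps_X) ^ (n + k + 1) :: complex fps) * (1 - fps_X) ^ (n + k + 1) = 1"
    by (rule inverse_mult_eq_1) simp
  ultimately show ?thesis
    by (simp add: mult.assoc)
qed

lemma bell_diag_expand:
  fixes a :: "complex fps"
  assumes a0: "fps_nth a 0 = 1"
  shows "fact (n + m) / fact m * fps_nth (a ^ (m + 1)) n =
    (\<Sum>k\<le>n. fact (n + k) / fact k * fps_nth (a * (a - 1) ^ k) n * of_nat ((m + n) choose (n + k)))"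
proof -
  have z: "fps_nth (a * (a - 1) ^ k) n = 0" if "k > n" for k
    using riordan_lower[of "a - 1" n k a] a0 that by (simp add: riordan_def)
  have "a ^ (m + 1) = a * ((a - 1) + 1) ^ m" by simp
  also have "\<dots> = (\<Sum>k\<le>m. of_nat (m choose k) * (a * (a - 1) ^ k))"
    by (subst binomial_ring) (simp add: sum_distrib_left mult_ac)
  finally have "fps_nth (a ^ (m + 1)) n = (\<Sum>k\<le>m. of_nat (m choose k) * fps_nth (a * (a - 1) ^ k) n)"
    by (simp add: fps_sum_nth fps_of_nat[symmetric])
  also have "\<dots> = (\<Sum>k\<le>max m n. of_nat (m choose k) * fps_nth (a * (a - 1) ^ k) n)"
    by (intro sum.mono_neutral_left) auto
  also have "\<dots> = (\<Sum>k\<le>n. of_nat (m choose k) * fps_nth (a * (a - 1) ^ k) n)"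
    by (intro sum.mono_neutral_right) (auto simp: z)
  finally have e: "fps_nth (a ^ (m + 1)) n = \<dots>" .
  have c: "fact (n + m) / fact m * of_nat (m choose k) =
      fact (n + k) / fact k * (of_nat ((m + n) choose (n + k)) :: complex)" for k
  proof (cases "k \<le> m")
    case True
    have "of_nat (m choose k) = (fact m / (fact k * fact (m - k)) :: complex)"
      using True by (simp add: binomial_fact)
    moreover have "of_nat ((m + n) choose (n + k)) = (fact (m + n) / (fact (n + k) * fact (m - k)) :: complex)"
      using True by (simp add: binomial_fact)
    ultimately show ?thesis by (simp add: add_ac)
  qed (simp add: binomial_eq_0)
  have t: "fact (n + m) / fact m * (of_nat (m choose k) * x) =
      fact (n + k) / fact k * x * (of_nat ((m + n) choose (n + k)) :: complex)" for k x
    by (simp only: mult.assoc[symmetric] c) (simp only: mult_ac)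
  show ?thesis
    unfolding e sum_distrib_left t ..
qed

text \<open>Existence and degree bound.\<close>

lemma numerator_poly_exists:
  fixes a :: "complex fps"
  assumes a0: "fps_nth a 0 = 1"
  shows "\<exists>p. degree p \<le> n \<and>
    (1 - fps_X) ^ (2 * n + 1) * Abs_fps (\<lambda>m. fact (n + m) / fact m * fps_nth (a ^ (m + 1)) n)
    = fps_of_poly p"
proof -
  define d where "d k = fact (n + k) / fact k * fps_nth (a * (a - 1) ^ k) n" for k
  define p where "p = (\<Sum>k\<le>n. smult (d k) (monom 1 k * [:1, -1:] ^ (n - k)))"
  have X: "fps_of_poly [:1, -1:] = (1 - fps_X :: complex fps)"
    by (simp add: fps_of_poly_pCons)
  have "degree p \<le> n"
    unfolding p_def
  proof (intro degree_sum_le)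
    fix k assume "k \<in> {..n}"
    then have "degree (monom (1::complex) k) + degree ([:1, -1:] ^ (n - k) :: complex poly) \<le> n"
      by (simp add: degree_monom_eq degree_power_eq)
    then show "degree (smult (d k) (monom 1 k * [:1, -1:] ^ (n - k))) \<le> n"
      by (meson degree_mult_le degree_smult_le order_trans)
  qed simp
  moreover have "(1 - fps_X) ^ (2 * n + 1) *
      Abs_fps (\<lambda>m. fact (n + m) / fact m * fps_nth (a ^ (m + 1)) n) = fps_of_poly p"
  proof -
    have "Abs_fps (\<lambda>m. fact (n + m) / fact m * fps_nth (a ^ (m + 1)) n) =
       (\<Sum>k\<le>n. fps_const (d k) * Abs_fps (\<lambda>m. of_nat ((m + n) choose (n + k))))"
      by (rule fps_ext) (simp only: bell_diag_expand[OF a0] d_def fps_sum_nth fps_mult_left_const_nth fps_nth_Abs_fps)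
    moreover have "(1 - fps_X) ^ (2 * n + 1) *
        (fps_const (d k) * Abs_fps (\<lambda>m. of_nat ((m + n) choose (n + k)))) =
        fps_const (d k) * (fps_X ^ k * (1 - fps_X) ^ (n - k))" if "k \<le> n" for k
    proof -
      have "2 * n + 1 = (n + k + 1) + (n - k)" using that by simp
      then have "(1 - fps_X :: complex fps) ^ (2 * n + 1) = (1 - fps_X) ^ (n + k + 1) * (1 - fps_X) ^ (n - k)"
        by (metis power_add)
      then have "(1 - fps_X) ^ (2 * n + 1) *
          (fps_const (d k) * Abs_fps (\<lambda>m. of_nat ((m + n) choose (n + k)))) =
          fps_const (d k) * ((Abs_fps (\<lambda>m. of_nat ((m + n) choose (n + k))) *
            (1 - fps_X) ^ (n + k + 1)) * (1 - fps_X) ^ (n - k))"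
        by (simp only: mult_ac)
      then show ?thesis
        by (simp only: binomial_gf)
    qed
    ultimately have "(1 - fps_X) ^ (2 * n + 1) *
        Abs_fps (\<lambda>m. fact (n + m) / fact m * fps_nth (a ^ (m + 1)) n) =
        (\<Sum>k\<le>n. fps_const (d k) * (fps_X ^ k * (1 - fps_X) ^ (n - k)))"
      by (simp only: sum_distrib_left) (intro sum.cong, simp_all only: atMost_iff)
    then show ?thesis
      by (simp only: p_def fps_of_poly_sum fps_of_poly_smult fps_of_poly_mult
          fps_of_poly_monom' fps_of_poly_power X)
  qed
  ultimately show ?thesis by blast
qed

lemma numerator_poly_bell:
  fixes a :: "complex fps"
  assumes a0: "fps_nth a 0 = 1"
  shows "fps_of_poly (numerator_poly (exp_riordan a (fps_X * a)) n) =
      (1 - fps_X) ^ (2 * n + 1) * Abs_fps (\<lambda>m. fact (n + m) / fact m * fps_nth (a ^ (m + 1)) n)"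
    and "degree (numerator_poly (exp_riordan a (fps_X * a)) n) \<le> n"
proof -
  define F where "F = Abs_fps (\<lambda>m. fact (n + m) / fact m * fps_nth (a ^ (m + 1)) n)"
  obtain p where p: "degree p \<le> n" "(1 - fps_X) ^ (2 * n + 1) * F = fps_of_poly p"
    using numerator_poly_exists[OF a0, of n] unfolding F_def by blast
  have u: "fps_nth ((1 - fps_X :: complex fps) ^ (2 * n + 1)) 0 \<noteq> 0"
    by (simp add: fps_nth_power_0)
  have div: "F = fps_of_poly q / (1 - fps_X) ^ (2 * n + 1) \<longleftrightarrow>
       (1 - fps_X) ^ (2 * n + 1) * F = fps_of_poly q" for q
    unfolding fps_divide_unit[OF u]
  proof
    let ?w = "(1 - fps_X :: complex fps) ^ (2 * n + 1)"
    have w: "inverse ?w * ?w = 1"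
      by (rule inverse_mult_eq_1[OF u])
    { assume "F = fps_of_poly q * inverse ?w"
      then have "?w * F = fps_of_poly q * (inverse ?w * ?w)"
        by (simp only: mult_ac)
      then show "?w * F = fps_of_poly q"
        by (simp only: w mult_1_right) }
    { assume "?w * F = fps_of_poly q"
      then have "fps_of_poly q * inverse ?w = F * (inverse ?w * ?w)"
        by (simp only: mult_ac flip: \<open>?w * F = fps_of_poly q\<close>)
      then show "F = fps_of_poly q * inverse ?w"
        by (simp only: w mult_1_right) }
  qed
  have "numerator_poly (exp_riordan a (fps_X * a)) n = p"
    unfolding numerator_poly_def exp_riordan_bell_diag F_def[symmetric] div p(2)
    by (auto simp: fps_of_poly_eq_iff)
  then show "fps_of_poly (numerator_poly (exp_riordan a (fps_X * a)) n) =
      (1 - fps_X) ^ (2 * n + 1) * Abs_fps (\<lambda>m. fact (n + m) / fact m * fps_nth (a ^ (m + 1)) n)"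
    and "degree (numerator_poly (exp_riordan a (fps_X * a)) n) \<le> n"
    using p by (simp_all only: F_def)
qed

end

theory Submission
  imports Defs
begin

text \<open>Put \<open>e\<^sub>k = [x\<^sup>n] a (a - 1)\<^sup>k\<close> and \<open>D\<^sub>k = (n + k)! / k! e\<^sub>k\<close>. Then
  \<open>h\<^sub>n(t) = \<Sum>\<^sub>k D\<^sub>k t\<^sup>k (1 - t)\<^sup>n\<^sup>-\<^sup>k\<close>, and substituting \<open>t = (y - 1) / y\<close> turns the symmetry of
  \<open>h\<^sub>n\<close> into \<open>D(y - 1) = (-1)\<^sup>n D(-y)\<close> for \<open>D(y) = \<Sum>\<^sub>k D\<^sub>k y\<^sup>k\<close>. Up to the factor \<open>(n - 1)!\<close>,
  the coefficients \<open>[x\<^sup>n] a a\<^sup>-\<^sup>1\<close> and \<open>[x\<^sup>n] a a\<^sup>-\<^sup>n\<close> are the integrals of \<open>(1 - y)\<^sup>n\<^sup>-\<^sup>1 D(-y)\<close>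
  and \<open>y\<^sup>n\<^sup>-\<^sup>1 D(-y)\<close> over \<open>[0, 1]\<close>, so under the symmetry they vanish
  together. Since the first one vanishes for \<open>n \<ge> 1\<close>, the series \<open>c = 1 / a\<close> satisfies
  \<open>[x\<^sup>n] c\<^sup>n\<^sup>-\<^sup>1 = 0\<close> for \<open>n \<ge> 2\<close>, which forces \<open>c\<close> to be linear. Conversely, for the geometric
  series \<open>h\<^sub>n(t) = n! \<phi>\<^sup>n \<Sum>\<^sub>j (n choose j)\<^sup>2 t\<^sup>j\<close>.\<close>

section \<open>A beta integral as an alternating binomial sum\<close>

text \<open>Both sides equal the integral of \<open>y^(n-1) * (1-y)^j\<close> over [0, 1]. Instead
  of integrating, the induction uses Pascal's rule in the form
  \<open>S (Suc j) n = S j n - S j (Suc n)\<close>.\<close>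

lemma sum_alternating_binomial_divide:
  fixes n j :: nat
  assumes "n > 0"
  shows "(\<Sum>k\<le>j. (- 1) ^ k * of_nat (j choose k) / of_nat (n + k)) =
    (fact j * fact (n - 1) / fact (n + j) :: 'a :: field_char_0)"
  using assms
proof (induction j arbitrary: n)
  case 0
  then show ?case
    by (cases n) (simp_all add: field_simps del: of_nat_Suc)
next
  case (Suc j)
  define S :: "nat \<Rightarrow> nat \<Rightarrow> 'a"
    where "S = (\<lambda>j n. \<Sum>k\<le>j. (- 1) ^ k * of_nat (j choose k) / of_nat (n + k))"
  have "S (Suc j) n = 1 / of_nat n +
      (\<Sum>k\<le>j. (- 1) ^ Suc k * of_nat (j choose Suc k) / of_nat (n + Suc k)) - S j (Suc n)"
    unfolding S_def
    by (subst sum.atMost_Suc_shift)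
      (simp add: add_divide_distrib diff_divide_distrib ring_distribs sum.distrib sum_negf sum_subtractf)
  also have "1 / of_nat n +
      (\<Sum>k\<le>j. (- 1) ^ Suc k * of_nat (j choose Suc k) / of_nat (n + Suc k)) =
      (\<Sum>k\<le>Suc j. (- 1) ^ k * of_nat (j choose k) / (of_nat (n + k) :: 'a))"
    by (subst sum.atMost_Suc_shift) simp
  also have "\<dots> = S j n"
    by (simp add: S_def)
  finally have "S (Suc j) n = S j n - S j (Suc n)" .
  also have "\<dots> = fact j * fact (n - 1) / fact (n + j) - fact j * fact n / fact (Suc n + j)"
    using Suc.IH[of n] Suc.IH[of "Suc n"] Suc.prems by (simp add: S_def add.assoc)
  also have "\<dots> = fact (Suc j) * fact (n - 1) / fact (n + Suc j)"
  proof -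
    obtain l where n: "n = Suc l"
      using Suc.prems by (cases n) auto
    have "of_nat (Suc (n + j)) \<noteq> (0 :: 'a)"
      by (simp only: of_nat_eq_0_iff)
    then show ?thesis
      by (simp add: n divide_simps del: of_nat_Suc) (simp add: algebra_simps)
  qed
  finally show ?case
    by (simp add: S_def)
qed

section \<open>Explicit form of the numerator polynomials\<close>

text \<open>By \<open>bell_diag_expand\<close> the diagonal has generating function
  \<open>\<Sum>k. d k * t^k / (1-t)^(n+k+1)\<close>, and multiplication by
  \<open>(1-t)^(2n+1)\<close> leaves the stated sum. \<open>numerator_poly_exists\<close> only
  asserts existence, so the polynomial is rebuilt here.\<close>

lemma poly_numerator_poly_bell:
  assumes a0: "fps_nth a 0 = 1"
  shows "poly (numerator_poly (exp_riordan a (fps_X * a)) n) t =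
    (\<Sum>k\<le>n. fact (n + k) / fact k * fps_nth (a * (a - 1) ^ k) n * t ^ k * (1 - t) ^ (n - k))"
proof -
  define d where "d k = fact (n + k) / fact k * fps_nth (a * (a - 1) ^ k) n" for k
  define p where "p = (\<Sum>k\<le>n. smult (d k) (monom 1 k * [:1, -1:] ^ (n - k)))"
  let ?G = "\<lambda>k. Abs_fps (\<lambda>m. of_nat ((m + n) choose (n + k)) :: complex)"
  have X: "fps_of_poly [:1, -1:] = (1 - fps_X :: complex fps)"
    by (simp add: fps_of_poly_pCons)
  have "fps_of_poly (numerator_poly (exp_riordan a (fps_X * a)) n) =
      (1 - fps_X) ^ (2 * n + 1) * Abs_fps (\<lambda>m. fact (n + m) / fact m * fps_nth (a ^ (m + 1)) n)"
    by (rule numerator_poly_bell(1)[OF a0])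
  also have "Abs_fps (\<lambda>m. fact (n + m) / fact m * fps_nth (a ^ (m + 1)) n) =
      (\<Sum>k\<le>n. fps_const (d k) * ?G k)"
    by (rule fps_ext)
      (simp only: bell_diag_expand[OF a0] d_def fps_sum_nth fps_mult_left_const_nth fps_nth_Abs_fps)
  also have "(1 - fps_X) ^ (2 * n + 1) * \<dots> =
      (\<Sum>k\<le>n. fps_const (d k) * (fps_X ^ k * (1 - fps_X) ^ (n - k)))"
    unfolding sum_distrib_left
  proof (intro sum.cong refl)
    fix k assume "k \<in> {..n}"
    then have "2 * n + 1 = (n + k + 1) + (n - k)" by simp
    then have "(1 - fps_X :: complex fps) ^ (2 * n + 1) =
        (1 - fps_X) ^ (n + k + 1) * (1 - fps_X) ^ (n - k)"
      by (metis power_add)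
    then have "(1 - fps_X) ^ (2 * n + 1) * (fps_const (d k) * ?G k) =
        fps_const (d k) * ((?G k * (1 - fps_X) ^ (n + k + 1)) * (1 - fps_X) ^ (n - k))"
      by (simp only: mult_ac)
    then show "(1 - fps_X) ^ (2 * n + 1) * (fps_const (d k) * ?G k) =
        fps_const (d k) * (fps_X ^ k * (1 - fps_X) ^ (n - k))"
      by (simp only: binomial_gf)
  qed
  also have "\<dots> = fps_of_poly p"
    by (simp only: p_def fps_of_poly_sum fps_of_poly_smult fps_of_poly_mult
        fps_of_poly_monom' fps_of_poly_power X)
  finally have "numerator_poly (exp_riordan a (fps_X * a)) n = p"
    by (simp add: fps_of_poly_eq_iff)
  then show ?thesis
    by (simp add: p_def d_def poly_sum poly_monom mult.assoc)
qed

section \<open>Negative powers of a series\<close>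

text \<open>Since \<open>b\<close> has no constant term, \<open>b^k\<close> has no terms below
  \<open>x^k\<close>, so only \<open>k \<le> n\<close> contribute.\<close>

lemma fps_mult_compose_nth:
  fixes f g b :: "'a :: comm_ring_1 fps"
  assumes "fps_nth b 0 = 0"
  shows "fps_nth (f * (g oo b)) n = (\<Sum>k\<le>n. fps_nth g k * fps_nth (f * b ^ k) n)"
proof -
  have z: "fps_nth (b ^ k) i = 0" if "i < k" for i k
    using startsby_zero_power_prefix[OF assms] that by blast
  have "fps_nth (f * (g oo b)) n =
      (\<Sum>i=0..n. \<Sum>k\<le>n. fps_nth f i * (fps_nth g k * fps_nth (b ^ k) (n - i)))"
    unfolding fps_mult_nth fps_compose_nth sum_distrib_left
    by (intro sum.cong refl sum.mono_neutral_left) (auto simp: z)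
  also have "\<dots> = (\<Sum>k\<le>n. fps_nth g k * fps_nth (f * b ^ k) n)"
    by (subst sum.swap) (simp add: fps_mult_nth sum_distrib_left mult_ac)
  finally show ?thesis .
qed

text \<open>The series \<open>(1+x)^(-r)\<close> composed with \<open>a - 1\<close> is
  \<open>a^(-r)\<close>, and its coefficients are negative binomials. The cases of interest are
  \<open>r = 1\<close> and \<open>r = n\<close>.\<close>

lemma fps_nth_mult_inverse_power:
  fixes a :: "'a :: field_char_0 fps"
  assumes a0: "fps_nth a 0 = 1" and "r > 0"
  shows "fps_nth (a * inverse a ^ r) n =
    (\<Sum>k\<le>n. (- 1) ^ k * of_nat ((r - 1 + k) choose k) * fps_nth (a * (a - 1) ^ k) n)"
proof -
  have b0: "fps_nth (a - 1) 0 = 0"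
    using a0 by simp
  have "inverse ((1 + fps_X) ^ r) oo (a - 1) = inverse ((1 + fps_X) ^ r oo (a - 1))"
    by (rule fps_inverse_compose[OF b0]) (simp add: fps_nth_power_0)
  also have "(1 + fps_X) ^ r oo (a - 1) = a ^ r"
    using b0 by (simp add: fps_compose_power[symmetric] fps_compose_add_distrib)
  finally have "inverse a ^ r = inverse ((1 + fps_X) ^ r) oo (a - 1)"
    by (simp add: fps_inverse_power)
  moreover have "fps_nth (inverse ((1 + fps_X) ^ r)) k =
      ((- 1) ^ k * of_nat ((r - 1 + k) choose k) :: 'a)" for k
    using one_minus_const_fps_X_neg_power'[of r "- 1 :: 'a"] \<open>r > 0\<close>
    by (simp add: fps_const_neg[symmetric] mult.commute del: fps_const_neg)
  ultimately show ?thesis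
    by (simp add: fps_mult_compose_nth[OF b0])
qed

section \<open>Coefficient conditions that force linearity\<close>

text \<open>First-order perturbation: for \<open>f = g + x^n r\<close>, the power \<open>f^m\<close>
  is \<open>g^m + m x^n r g^(m-1)\<close> up to terms of order at least \<open>2n\<close>.\<close>

lemma fps_nth_power_agree:
  fixes f g :: "'a :: comm_ring_1 fps"
  assumes g0: "fps_nth g 0 = 1" and "n > 0" and eq: "\<And>i. i < n \<Longrightarrow> fps_nth f i = fps_nth g i"
  shows "fps_nth (f ^ m) n = fps_nth (g ^ m) n + of_nat m * (fps_nth f n - fps_nth g n)"
proof -
  define r where "r = fps_shift n (f - g)"
  have f: "f = g + fps_X ^ n * r"
    by (rule fps_ext) (use eq in \<open>simp add: r_def fps_X_power_mult_nth\<close>)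
  have "\<exists>s. f ^ m = g ^ m + fps_X ^ n * s \<and> fps_nth s 0 = of_nat m * fps_nth r 0"
  proof (induction m)
    case 0
    show ?case by (rule exI[of _ 0]) simp
  next
    case (Suc m)
    then obtain s where s: "f ^ m = g ^ m + fps_X ^ n * s" "fps_nth s 0 = of_nat m * fps_nth r 0"
      by blast
    show ?case
    proof (intro exI conjI)
      \<comment> \<open>The witness is the cofactor of \<open>x^n\<close> in
        \<open>(g + x^n r) (g^m + x^n s)\<close>; its last summand has no constant term because
        \<open>n > 0\<close>.\<close>
      show "f ^ Suc m = g ^ Suc m + fps_X ^ n * (g * s + r * g ^ m + fps_X ^ n * r * s)"
        unfolding power_Suc s(1) by (simp add: f algebra_simps)
      show "fps_nth (g * s + r * g ^ m + fps_X ^ n * r * s) 0 = of_nat (Suc m) * fps_nth r 0"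
        using g0 \<open>n > 0\<close> s(2) by (simp add: fps_nth_power_0 power_0_left algebra_simps)
    qed
  qed
  then show ?thesis
    by (auto simp: fps_X_power_mult_nth r_def)
qed

text \<open>The conditions determine each coefficient from the earlier ones, with the nonzero factor
  \<open>n - 1\<close>. The linear polynomial \<open>l\<close> with the same first two coefficients
  satisfies them too, as \<open>l^(n-1)\<close> has degree below \<open>n\<close>.\<close>

lemma fps_linear_of_power_nth_eq_0:
  fixes c :: "'a :: field_char_0 fps"
  assumes c0: "fps_nth c 0 = 1" and c: "\<And>n. n \<ge> 2 \<Longrightarrow> fps_nth (c ^ (n - 1)) n = 0"
  shows "c = 1 + fps_const (fps_nth c 1) * fps_X"
proof -
  define l where "l = fps_of_poly [:1, fps_nth c 1:]"
  have l: "l = 1 + fps_const (fps_nth c 1) * fps_X"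
    by (simp add: l_def fps_of_poly_pCons)
  have l0: "fps_nth l 0 = 1"
    by (simp add: l)
  have "fps_nth c n = fps_nth l n" for n
  proof (induction n rule: less_induct)
    case (less n)
    show ?case
    proof (cases "n \<ge> 2")
      case True
      have "degree ([:1, fps_nth c 1:] ^ (n - 1)) \<le> degree [:1, fps_nth c 1:] * (n - 1)"
        by (rule degree_power_le)
      also have "\<dots> < n"
        using True by (simp split: if_splits)
      finally have "fps_nth (l ^ (n - 1)) n = 0"
        unfolding l_def fps_of_poly_power[symmetric] fps_of_poly_nth by (rule coeff_eq_0)
      moreover have "fps_nth (c ^ (n - 1)) n =
          fps_nth (l ^ (n - 1)) n + of_nat (n - 1) * (fps_nth c n - fps_nth l n)"
        using True by (intro fps_nth_power_agree l0 less.IH) simp_all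
      ultimately have "of_nat (n - 1) * (fps_nth c n - fps_nth l n) = 0"
        using c[OF True] by simp
      moreover have "of_nat (n - 1) \<noteq> (0 :: 'a)"
        using True by (simp only: of_nat_eq_0_iff)
      ultimately show ?thesis
        by simp
    next
      case False
      then have "n = 0 \<or> n = 1" by auto
      then show ?thesis
        using c0 by (auto simp: l)
    qed
  qed
  then show ?thesis
    unfolding l[symmetric] by (rule fps_ext)
qed

section \<open>From symmetry to a vanishing coefficient\<close>

text \<open>Compares the coefficients of \<open>y^i\<close> in
  \<open>D(y - 1) = (-1)^n D(-y)\<close>, whose two sides are \<open>P\<close> and
  \<open>Q\<close>.\<close>

lemma symmetric_binomial_coeff:
  fixes D :: "nat \<Rightarrow> complex"
  assumes sym: "\<And>t. t \<noteq> 0 \<Longrightarrow> (\<Sum>k\<le>n. D k * t ^ k * (1 - t) ^ (n - k)) =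
      t ^ n * (\<Sum>k\<le>n. D k * (1 / t) ^ k * (1 - 1 / t) ^ (n - k))"
    and "i \<le> n"
  shows "(\<Sum>j\<le>n. (- 1) ^ j * D j * ((- 1) ^ i * of_nat (j choose i))) = (- 1) ^ n * ((- 1) ^ i * D i)"
proof -
  define P where "P = (\<Sum>k\<le>n. smult (D k) ([:-1, 1:] ^ k))"
  define Q where "Q = (\<Sum>k\<le>n. smult ((- 1) ^ n * D k) ([:0, -1:] ^ k))"
  \<comment> \<open>Outside 0 and 1 the value \<open>t = (y - 1) / y\<close> is defined and
    nonzero.\<close>
  have PQ: "poly P y = poly Q y" if y: "y \<notin> {0, 1}" for y
  proof -
    have nz: "y \<noteq> 0" "y - 1 \<noteq> 0" using y by auto
    have 1: "1 - (y - 1) / y = 1 / y" "1 - 1 / ((y - 1) / y) = - 1 / (y - 1)"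
      using nz by (simp_all add: field_simps)
    have "poly P y = y ^ n * (\<Sum>k\<le>n. D k * ((y - 1) / y) ^ k * (1 / y) ^ (n - k))"
      unfolding P_def poly_sum sum_distrib_left
    proof (intro sum.cong refl)
      fix k assume "k \<in> {..n}"
      then have "y ^ n = y ^ k * y ^ (n - k)" by (simp flip: power_add)
      then show "poly (smult (D k) ([:- 1, 1:] ^ k)) y =
          y ^ n * (D k * ((y - 1) / y) ^ k * (1 / y) ^ (n - k))"
        using nz by (simp add: power_divide)
    qed
    also have "(\<Sum>k\<le>n. D k * ((y - 1) / y) ^ k * (1 / y) ^ (n - k)) = ((y - 1) / y) ^ n *
        (\<Sum>k\<le>n. D k * (1 / ((y - 1) / y)) ^ k * (- 1 / (y - 1)) ^ (n - k))"
      using sym[of "(y - 1) / y"] nz unfolding 1 by simp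
    also have "y ^ n * \<dots> = (y - 1) ^ n *
        (\<Sum>k\<le>n. D k * (1 / ((y - 1) / y)) ^ k * (- 1 / (y - 1)) ^ (n - k))"
      using nz by (simp add: power_divide)
    also have "\<dots> = poly Q y"
      unfolding Q_def poly_sum sum_distrib_left
    proof (intro sum.cong refl)
      fix k assume "k \<in> {..n}"
      then have "(y - 1) ^ n = (y - 1) ^ k * (y - 1) ^ (n - k)"
        and "(- 1 :: complex) ^ n = (- 1) ^ k * (- 1) ^ (n - k)" by (simp_all flip: power_add)
      moreover have "(- y) ^ k = (- 1) ^ k * y ^ k"
        by (rule power_minus)
      moreover have "(y - 1) ^ (n - k) * (- (1 / (y - 1))) ^ (n - k) = (- 1) ^ (n - k)"
        using nz by (simp flip: power_mult_distrib)
      moreover have "(- 1 :: complex) ^ k * ((- 1) ^ (n - k) * (- 1) ^ k) = (- 1) ^ (n - k)"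
        by (subst mult.left_commute) (simp flip: power_add)
      ultimately show "(y - 1) ^ n * (D k * (1 / ((y - 1) / y)) ^ k * (- 1 / (y - 1)) ^ (n - k)) =
          poly (smult ((- 1) ^ n * D k) ([:0, - 1:] ^ k)) y"
        using nz by (simp add: power_divide)
    qed
    finally show ?thesis .
  qed
  \<comment> \<open>Agreement outside two points gives infinitely many roots of
    \<open>P - Q\<close>.\<close>
  have "P = Q"
  proof (rule ccontr)
    assume "P \<noteq> Q"
    then have "finite {y. poly (P - Q) y = 0}"
      by (intro poly_roots_finite) simp
    moreover have "- {0, 1} \<subseteq> {y. poly (P - Q) y = 0}"
      using PQ by auto
    ultimately have "finite (- {0, 1 :: complex})"
      by (rule finite_subset[rotated])
    then show False
      using infinite_UNIV_char_0[where 'a = complex] by (simp add: finite_compl)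
  qed
  have "(- 1) ^ j * D j * ((- 1) ^ i * of_nat (j choose i)) = D j * coeff ([:- 1, 1:] ^ j) i" for j
  proof (cases "i \<le> j")
    case True
    then have "(- 1 :: complex) ^ j = (- 1) ^ (j - i) * (- 1) ^ i"
      by (simp flip: power_add)
    moreover have "(- 1 :: complex) ^ i * (- 1) ^ i = 1"
      by (simp flip: power_add)
    ultimately show ?thesis
      using coeff_linear_poly_power[of i j "- 1 :: complex" 1] True
      by (simp add: mult_ac)
  next
    case False
    moreover have "degree ([:- 1, 1 :: complex:] ^ j) = j"
      by (simp add: degree_power_eq)
    ultimately show ?thesis
      by (simp add: coeff_eq_0)
  qed
  then have "(\<Sum>j\<le>n. (- 1) ^ j * D j * ((- 1) ^ i * of_nat (j choose i))) = coeff P i"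
    by (simp only: P_def coeff_sum coeff_smult)
  also have "\<dots> = coeff Q i"
    by (simp only: \<open>P = Q\<close>)
  also have "Q = (\<Sum>k\<le>n. monom ((- 1) ^ n * D k * (- 1) ^ k) k)"
    unfolding Q_def
  proof (intro sum.cong refl)
    fix k
    have "[:0, - 1 :: complex:] = monom (- 1) 1"
      by (simp add: monom_Suc monom_0)
    then show "smult ((- 1) ^ n * D k) ([:0, - 1:] ^ k) = monom ((- 1) ^ n * D k * (- 1) ^ k) k"
      by (simp add: monom_power smult_monom)
  qed
  also have "coeff \<dots> i = (- 1) ^ n * ((- 1) ^ i * D i)"
    using \<open>i \<le> n\<close> by (simp add: coeff_sum mult_ac)
  finally show ?thesis .
qed

lemma numerator_poly_symmetric_imp_nth_eq_0:
  assumes a0: "fps_nth a 0 = 1" and "n > 0"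
    and sym: "\<And>t. t \<noteq> 0 \<Longrightarrow> poly (numerator_poly (exp_riordan a (fps_X * a)) n) t =
      t ^ n * poly (numerator_poly (exp_riordan a (fps_X * a)) n) (1 / t)"
  shows "fps_nth (a * inverse a ^ n) n = 0"
proof -
  define e where "e k = fps_nth (a * (a - 1) ^ k) n" for k
  define D where "D k = fact (n + k) / fact k * e k" for k
  have D: "(\<Sum>j\<le>n. (- 1) ^ j * D j * ((- 1) ^ i * of_nat (j choose i))) =
      (- 1) ^ n * ((- 1) ^ i * D i)" if "i \<le> n" for i
    by (rule symmetric_binomial_coeff[OF _ that])
      (use sym in \<open>simp only: poly_numerator_poly_bell[OF a0] D_def e_def\<close>)
  \<comment> \<open>The weight \<open>1 / (n + i)\<close> is the integral of
    \<open>y^(n-1) * y^i\<close> over [0, 1].\<close>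
  have "(- 1) ^ n * (\<Sum>i\<le>n. (- 1) ^ i * D i / of_nat (n + i)) =
      (\<Sum>i\<le>n. (\<Sum>j\<le>n. (- 1) ^ j * D j * ((- 1) ^ i * of_nat (j choose i))) / of_nat (n + i))"
    unfolding sum_distrib_left by (intro sum.cong refl) (simp only: D atMost_iff times_divide_eq_right)
  also have "\<dots> = (\<Sum>j\<le>n. (- 1) ^ j * D j *
      (\<Sum>i\<le>n. (- 1) ^ i * of_nat (j choose i) / of_nat (n + i)))"
    unfolding sum_divide_distrib sum_distrib_left by (subst sum.swap) (simp only: times_divide_eq_right)
  also have "\<dots> = (\<Sum>j\<le>n. fact (n - 1) * ((- 1) ^ j * e j))"
  proof (intro sum.cong refl)
    fix j assume j: "j \<in> {..n}"
    have "(\<Sum>i\<le>n. (- 1) ^ i * of_nat (j choose i) / of_nat (n + i)) =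
        (\<Sum>i\<le>j. (- 1) ^ i * of_nat (j choose i) / (of_nat (n + i) :: complex))"
      using j by (intro sum.mono_neutral_right) auto
    also have "\<dots> = fact j * fact (n - 1) / fact (n + j)"
      by (rule sum_alternating_binomial_divide[OF \<open>n > 0\<close>])
    finally show "(- 1) ^ j * D j * (\<Sum>i\<le>n. (- 1) ^ i * of_nat (j choose i) / of_nat (n + i)) =
        fact (n - 1) * ((- 1) ^ j * e j)"
      by (simp add: D_def)
  qed
  also have "\<dots> = fact (n - 1) * fps_nth (a * inverse a ^ 1) n"
    \<comment> \<open>For \<open>r = 1\<close> all binomials equal 1, leaving the alternating sum of
      the \<open>e j\<close>.\<close>
    by (subst fps_nth_mult_inverse_power[OF a0]) (simp_all add: e_def sum_distrib_left)
  also have "a * inverse a ^ 1 = 1"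
    using a0 inverse_mult_eq_1[of a] by (simp add: mult.commute)
  finally have 0: "(\<Sum>i\<le>n. (- 1) ^ i * D i / of_nat (n + i)) = 0"
    using \<open>n > 0\<close> by simp
  \<comment> \<open>For \<open>r = n\<close> the same weights appear, since
    \<open>(n-1)! * (n-1+i choose i) = (n+i)! / (i! * (n+i))\<close>.\<close>
  have "fact (n - 1) * fps_nth (a * inverse a ^ n) n = (\<Sum>i\<le>n. (- 1) ^ i * D i / of_nat (n + i))"
    unfolding fps_nth_mult_inverse_power[OF a0 \<open>n > 0\<close>] sum_distrib_left
  proof (intro sum.cong refl)
    fix i
    obtain l where n: "n = Suc l"
      using \<open>n > 0\<close> by (cases n) auto
    have "of_nat ((n - 1 + i) choose i) = (fact (n - 1 + i) / (fact i * fact (n - 1)) :: complex)"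
      by (simp add: binomial_fact)
    moreover have "fact (n + i) = (of_nat (n + i) * fact (n - 1 + i) :: complex)"
      by (simp add: n)
    moreover have "of_nat (n + i) \<noteq> (0 :: complex)"
      using \<open>n > 0\<close> by (simp only: of_nat_eq_0_iff)
    ultimately show "fact (n - 1) * ((- 1) ^ i * of_nat ((n - 1 + i) choose i) *
        fps_nth (a * (a - 1) ^ i) n) = (- 1) ^ i * D i / of_nat (n + i)"
      by (simp add: D_def e_def)
  qed
  with 0 show ?thesis
    by simp
qed

section \<open>The geometric series\<close>

text \<open>From \<open>a - 1 = \<phi> x a\<close> the product is
  \<open>\<phi>^k x^k a^(k+1)\<close>, and powers of the geometric series have negative binomial
  coefficients.\<close>

lemma fps_nth_geometric_power:
  fixes \<phi> :: "'a :: field_char_0"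
  assumes "k \<le> n"
  defines "a \<equiv> 1 / (1 - fps_const \<phi> * fps_X)"
  shows "fps_nth (a * (a - 1) ^ k) n = \<phi> ^ n * of_nat (n choose k)"
proof -
  have a: "a = inverse (1 - fps_const \<phi> * fps_X)"
    by (simp add: a_def fps_divide_unit)
  then have "a * (1 - fps_const \<phi> * fps_X) = 1"
    using inverse_mult_eq_1[of "1 - fps_const \<phi> * fps_X"] by simp
  then have "a - 1 = fps_const \<phi> * fps_X * a"
    by (simp add: algebra_simps)
  then have "a * (a - 1) ^ k = fps_const (\<phi> ^ k) * (fps_X ^ k * a ^ Suc k)"
    by (simp add: power_mult_distrib fps_const_power mult_ac)
  also have "a ^ Suc k = Abs_fps (\<lambda>i. of_nat ((Suc k + i - 1) choose i) * \<phi> ^ i)"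
    unfolding a fps_inverse_power[symmetric] by (rule one_minus_const_fps_X_neg_power') simp
  finally show ?thesis
    using assms(1) binomial_symmetric[OF assms(1)]
    by (simp add: fps_X_power_mult_nth mult.left_commute[of "\<phi> ^ k"] flip: power_add)
qed

text \<open>Both sides are the coefficient of \<open>z\<^sup>n\<close> in \<open>(1 + z)\<^sup>n (1 + t z)\<^sup>n\<close>, as
  \<open>1 + t z = (1 - t) + t (1 + z)\<close>.\<close>

lemma sum_binomial_square:
  fixes t :: "'a :: field_char_0"
  shows "(\<Sum>k\<le>n. of_nat ((n choose k) * ((n + k) choose n)) * t ^ k * (1 - t) ^ (n - k)) =
    (\<Sum>j\<le>n. of_nat (n choose j) ^ 2 * t ^ j)"
proof -
  have one_plus: "fps_nth ((1 + fps_X) ^ m) i = (of_nat (m choose i) :: 'a)" for m i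
    using fps_binomial_of_nat[of m, where 'a = 'a] by (metis binomial_gbinomial fps_binomial_nth)
  define u where "u = fps_const t * (1 + fps_X :: 'a fps)"
  have split: "1 + fps_const t * fps_X = u + fps_const (1 - t)"
    by (simp add: u_def algebra_simps flip: fps_const_sub)
  have "(u + fps_const (1 - t)) ^ n =
      (\<Sum>k\<le>n. of_nat (n choose k) * u ^ k * fps_const (1 - t) ^ (n - k))"
    by (rule binomial_ring)
  then have "fps_nth ((1 + fps_X) ^ n * (1 + fps_const t * fps_X) ^ n) n =
      fps_nth (\<Sum>k\<le>n. fps_const (of_nat (n choose k) * t ^ k * (1 - t) ^ (n - k)) *
        (1 + fps_X) ^ (n + k)) n"
    unfolding split u_def
    by (simp only: sum_distrib_left, intro arg_cong[where f = "\<lambda>f. fps_nth f n"] sum.cong refl)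
      (simp add: power_mult_distrib fps_const_power power_add fps_of_nat[symmetric] mult_ac
        flip: fps_const_mult)
  also have "\<dots> = (\<Sum>k\<le>n. of_nat ((n choose k) * ((n + k) choose n)) * t ^ k * (1 - t) ^ (n - k))"
    by (simp add: fps_sum_nth one_plus mult_ac)
  finally have 1: "fps_nth ((1 + fps_X) ^ n * (1 + fps_const t * fps_X) ^ n) n = \<dots>" .
  have "(1 + fps_const t * fps_X) ^ n = (\<Sum>j\<le>n. fps_const (of_nat (n choose j) * t ^ j) * fps_X ^ j)"
    by (subst add.commute, subst binomial_ring)
      (simp add: power_mult_distrib fps_const_power fps_of_nat[symmetric] mult_ac flip: fps_const_mult)
  then have "fps_nth ((1 + fps_X) ^ n * (1 + fps_const t * fps_X) ^ n) n =
      (\<Sum>j\<le>n. of_nat (n choose j) * t ^ j * fps_nth (fps_X ^ j * (1 + fps_X) ^ n) n)"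
    by (simp add: sum_distrib_left fps_sum_nth mult.left_commute[of "(1 + fps_X) ^ n"]
        mult.commute[of "(1 + fps_X) ^ n"] mult.assoc)
  also have "\<dots> = (\<Sum>j\<le>n. of_nat (n choose j) ^ 2 * t ^ j)"
  proof (intro sum.cong refl)
    fix j assume "j \<in> {..n}"
    then have "j \<le> n" by simp
    then have "fps_nth (fps_X ^ j * (1 + fps_X) ^ n) n = (of_nat (n choose j) :: 'a)"
      using binomial_symmetric[of j n] by (simp add: fps_X_power_mult_nth one_plus)
    then show "of_nat (n choose j) * t ^ j * fps_nth (fps_X ^ j * (1 + fps_X) ^ n) n =
        of_nat (n choose j) ^ 2 * t ^ j"
      by (simp add: power2_eq_square)
  qed
  finally show ?thesis
    using 1 by simp
qed

text \<open>Here \<open>D k = n! \<phi>^n (n choose k) (n+k choose n)\<close>; passing to squared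
  binomials makes the coefficients visibly palindromic.\<close>

lemma poly_numerator_poly_geometric:
  fixes \<phi> :: complex
  defines "a \<equiv> 1 / (1 - fps_const \<phi> * fps_X)"
  shows "poly (numerator_poly (exp_riordan a (fps_X * a)) n) t =
    fact n * \<phi> ^ n * (\<Sum>j\<le>n. of_nat (n choose j) ^ 2 * t ^ j)"
proof -
  have a0: "fps_nth a 0 = 1"
    by (simp add: a_def fps_divide_unit)
  have "fact (n + k) / fact k = (fact n * of_nat ((n + k) choose n) :: complex)" for k
    by (simp add: binomial_fact)
  moreover have "fps_nth (a * (a - 1) ^ k) n = \<phi> ^ n * of_nat (n choose k)" if "k \<le> n" for k
    unfolding a_def using that by (rule fps_nth_geometric_power)
  ultimately show ?thesis
    unfolding poly_numerator_poly_bell[OF a0] sum_binomial_square[symmetric] sum_distrib_left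
    by (intro sum.cong refl) (simp add: mult_ac)
qed

section \<open>Both directions of the equivalence and the matrix form\<close>

theorem theorem4p4:
  fixes a :: "complex fps"
  assumes "fps_nth a 0 = 1"
  shows "((\<forall>n. \<forall>t. t \<noteq> 0 \<longrightarrow>
              poly (numerator_poly (exp_riordan a (fps_X * a)) n) t =
              t ^ n * poly (numerator_poly (exp_riordan a (fps_X * a)) n) (1 / t))
            \<longleftrightarrow> (\<exists>\<phi>. a = 1 / (1 - fps_const \<phi> * fps_X)))
       \<and> (\<forall>\<phi>. a = 1 / (1 - fps_const \<phi> * fps_X) \<longleftrightarrow>
            exp_riordan a (fps_X * a) =
            lower_mult (lower_mult (diag_matrix_inv (fps_exp 1)) (pascal_power \<phi>))
                       (diag_matrix (fps_exp 1)))"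
proof (intro conjI iffI allI impI)
  assume sym: "\<forall>n. \<forall>t. t \<noteq> 0 \<longrightarrow>
      poly (numerator_poly (exp_riordan a (fps_X * a)) n) t =
      t ^ n * poly (numerator_poly (exp_riordan a (fps_X * a)) n) (1 / t)"
  define c where "c = inverse a"
  have ac: "a * c = 1" and c0: "fps_nth c 0 = 1"
    using assms inverse_mult_eq_1[of a] by (simp_all add: c_def mult.commute)
  have "fps_nth (c ^ (n - 1)) n = 0" if "n \<ge> 2" for n
  proof -
    \<comment> \<open>The factor \<open>a\<close> cancels one factor \<open>c\<close>, which
      produces the exponent \<open>n - 1\<close>.\<close>
    have "a * c ^ n = c ^ (n - 1)"
      using that ac by (cases n) (simp_all flip: mult.assoc)
    moreover have "n > 0"
      using that by simp
    then have "fps_nth (a * inverse a ^ n) n = 0"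
      by (rule numerator_poly_symmetric_imp_nth_eq_0[OF assms]) (use sym in blast)
    ultimately show ?thesis
      by (simp only: c_def)
  qed
  then have "c = 1 + fps_const (fps_nth c 1) * fps_X"
    by (rule fps_linear_of_power_nth_eq_0[OF c0])
  also have "\<dots> = 1 - fps_const (- fps_nth c 1) * fps_X"
    by (simp only: fps_const_neg[symmetric] mult_minus_left diff_minus_eq_add)
  finally have "c = 1 - fps_const (- fps_nth c 1) * fps_X" .
  moreover have "a = 1 / c"
    using assms c0 by (simp add: fps_divide_unit c_def)
  ultimately show "\<exists>\<phi>. a = 1 / (1 - fps_const \<phi> * fps_X)"
    by metis
next
  fix n and t :: complex
  assume "\<exists>\<phi>. a = 1 / (1 - fps_const \<phi> * fps_X)" and t: "t \<noteq> 0"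
  then obtain \<phi> where a: "a = 1 / (1 - fps_const \<phi> * fps_X)"
    by blast
  \<comment> \<open>Reflecting \<open>j\<close> to \<open>n - j\<close> fixes the squared binomials
    and reverses the powers of \<open>t\<close>.\<close>
  have "(\<Sum>j\<le>n. of_nat (n choose j) ^ 2 * t ^ j) =
      (\<Sum>j\<le>n. of_nat (n choose (n - j)) ^ 2 * t ^ (n - j))"
    by (rule sum.nat_diff_reindex[symmetric, of _ "Suc n", simplified lessThan_Suc_atMost diff_Suc_Suc])
  also have "\<dots> = t ^ n * (\<Sum>j\<le>n. of_nat (n choose j) ^ 2 * (1 / t) ^ j)"
    unfolding sum_distrib_left
    using t by (intro sum.cong refl)
      (simp add: binomial_symmetric[symmetric] power_diff power_one_over divide_simps)
  finally show "poly (numerator_poly (exp_riordan a (fps_X * a)) n) t =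
      t ^ n * poly (numerator_poly (exp_riordan a (fps_X * a)) n) (1 / t)"
    unfolding a poly_numerator_poly_geometric by (simp add: mult_ac)
next
  fix \<phi>
  assume a: "a = 1 / (1 - fps_const \<phi> * fps_X)"
  then have "fps_X * a = fps_X / (1 - fps_const \<phi> * fps_X)"
    by (simp add: fps_divide_unit)
  then show "exp_riordan a (fps_X * a) =
      lower_mult (lower_mult (diag_matrix_inv (fps_exp 1)) (pascal_power \<phi>)) (diag_matrix (fps_exp 1))"
    unfolding conj_pascal_power using a by simp
next
  fix \<phi>
  assume "exp_riordan a (fps_X * a) =
      lower_mult (lower_mult (diag_matrix_inv (fps_exp 1)) (pascal_power \<phi>)) (diag_matrix (fps_exp 1))"
  \<comment> \<open>Column 0 is enough: its entries are \<open>i!\<close> times the coefficients of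
    the first series.\<close>
  then have "exp_riordan a (fps_X * a) i 0 = exp_riordan (1 / (1 - fps_const \<phi> * fps_X))
      (fps_X / (1 - fps_const \<phi> * fps_X)) i 0" for i
    by (simp add: conj_pascal_power)
  then show "a = 1 / (1 - fps_const \<phi> * fps_X)"
    by (intro fps_ext) (simp add: exp_riordan_def)
qed

end
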